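(* Let $N$ be a positive integer, let $Z=X+\sqrt{-1}Y\colon M_0\to\mathcal S_n$ be a smooth map on $M_0=\mathbb R^n\times T^n$ which does not depend on $y_1,\dots,y_n$, let $J=J_Z$ be the corresponding compatible almost complex structure on $(M_0,\omega_0)$, $g=\omega_0(\cdot,J\cdot)$, and $\Omega=(Y+XY^{-1}X)^{-1}ZY^{-1}$. The following conditions are equivalent: (1) All $m\in\mathbb Z^n$ are integrable, i.e. for every $m\in\mathbb Z^n$, $$\big((\partial_{x_i}\Omega)_x(m-Nx)\big)_j=\big((\partial_{x_j}\Omega)_x(m-Nx)\big)_i\qquad\text{for all } i,j=1,\dots,n \text{ and } x\in\mathbb R^n.$$ (2) $\partial_{x_i}\Omega_{jk}=\partial_{x_j}\Omega_{ik}$ for all $i,j,k=1,\dots,n$. (3) $\nabla^{LC}J=0$, where $\nabla^{LC}$ is the Levi-Civita connection with respect to $g$.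
   Context: $T^n=(\mathbb R/\mathbb Z)^n$, $(x,y)$ are the coordinates on $\mathbb R^n\times T^n$, $\omega_0=\sum_i dx_i\wedge dy_i$. $\mathcal S_n$ is the Siegel upper half space: symmetric complex $n\times n$ matrices $X+\sqrt{-1}Y$ ($X,Y$ real) with $Y$ positive definite. For $Z=X+\sqrt{-1}Y$, $J_Z$ is defined by $J_Z\big(\sum_i (u_x)_i\partial_{x_i}+(u_y)_i\partial_{y_i}\big)=\sum_i (v_x)_i\partial_{x_i}+(v_y)_i\partial_{y_i}$ with $v_x=XY^{-1}u_x-(Y+XY^{-1}X)u_y$ and $v_y=Y^{-1}u_x-Y^{-1}Xu_y$. Since $Z$ does not depend on $y$, $\Omega$ is a function of $x\in\mathbb R^n$ with values in complex $n\times n$ matrices; $(\cdot)_j$ denotes the $j$-th component of a vector. *)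

theory Defs
  imports "HOL-Analysis.Analysis"
begin

section \<open>Smooth maps\<close>

text \<open>The directional derivatives determine the Frechet derivative, so on a finite-dimensional
  domain the recursion below describes the usual classes \<open>C\<^sup>k\<close>.\<close>

primrec C_k :: "nat \<Rightarrow> ('a::real_normed_vector \<Rightarrow> 'b::real_normed_vector) \<Rightarrow> bool" where
  "C_k 0 f \<longleftrightarrow> continuous_on UNIV f"
| "C_k (Suc k) f \<longleftrightarrow>
     (\<forall>x. f differentiable (at x)) \<and> (\<forall>v. C_k k (\<lambda>x. frechet_derivative f (at x) v))"

definition smooth :: "('a::real_normed_vector \<Rightarrow> 'b::real_normed_vector) \<Rightarrow> bool" where
  "smooth f \<longleftrightarrow> (\<forall>k. C_k k f)"


section \<open>The manifold \<open>M\<^sub>0 = \<real>\<^sup>n \<times> T\<^sup>n\<close>\<close>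

text \<open>Maps on \<open>M\<^sub>0\<close> are represented by their lifts to the universal cover
  \<open>\<real>\<^sup>n \<times> \<real>\<^sup>n\<close>, that is, by maps of \<open>(x, y)\<close> that are invariant under \<open>\<int>\<^sup>n\<close>-translations of \<open>y\<close>.
  The tangent bundle is trivialised by the global frame
  \<open>\<partial>\<^sub>x\<^sub>1, \<dots>, \<partial>\<^sub>x\<^sub>n, \<partial>\<^sub>y\<^sub>1, \<dots>, \<partial>\<^sub>y\<^sub>n\<close>; a tangent vector is the pair
  \<open>(u\<^sub>x, u\<^sub>y)\<close> of its coefficient vectors.\<close>

type_synonym 'n M0 = "(real, 'n) vec \<times> (real, 'n) vec"
type_synonym 'n tangent = "(real, 'n) vec \<times> (real, 'n) vec"

definition smooth_M0 :: "('n::finite M0 \<Rightarrow> 'b::real_normed_vector) \<Rightarrow> bool" where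
  "smooth_M0 f \<longleftrightarrow> smooth f \<and>
     (\<forall>x y. \<forall>m :: int ^ 'n. f (x, y + (\<chi> i. of_int (m $ i))) = f (x, y))"

abbreviation vector_field :: "('n::finite M0 \<Rightarrow> 'n tangent) \<Rightarrow> bool" where
  "vector_field V \<equiv> smooth_M0 V"

definition along ::
    "('n::finite M0 \<Rightarrow> 'n tangent) \<Rightarrow> ('n M0 \<Rightarrow> 'b::real_normed_vector) \<Rightarrow> 'n M0 \<Rightarrow> 'b" where
  "along V f p = frechet_derivative f (at p) (V p)"

definition lie_bracket ::
    "('n::finite M0 \<Rightarrow> 'n tangent) \<Rightarrow> ('n M0 \<Rightarrow> 'n tangent) \<Rightarrow> 'n M0 \<Rightarrow> 'n tangent" where
  "lie_bracket V W p = along V W p - along W V p"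

definition omega0 :: "'n::finite tangent \<Rightarrow> 'n tangent \<Rightarrow> real" where
  "omega0 u v = (\<Sum>i\<in>UNIV. fst u $ i * snd v $ i - snd u $ i * fst v $ i)"


section \<open>Connections\<close>

type_synonym 'n conn =
  "('n M0 \<Rightarrow> 'n tangent) \<Rightarrow> ('n M0 \<Rightarrow> 'n tangent) \<Rightarrow> 'n M0 \<Rightarrow> 'n tangent"

definition affine_connection :: "'n::finite conn \<Rightarrow> bool" where
  "affine_connection D \<longleftrightarrow>
     (\<forall>V W. vector_field V \<longrightarrow> vector_field W \<longrightarrow> vector_field (D V W)) \<and>
     (\<forall>V V' W. vector_field V \<longrightarrow> vector_field V' \<longrightarrow> vector_field W \<longrightarrow>
        (\<forall>p. D (\<lambda>q. V q + V' q) W p = D V W p + D V' W p)) \<and>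
     (\<forall>f :: 'n M0 \<Rightarrow> real. \<forall>V W. smooth_M0 f \<longrightarrow> vector_field V \<longrightarrow> vector_field W \<longrightarrow>
        (\<forall>p. D (\<lambda>q. f q *\<^sub>R V q) W p = f p *\<^sub>R D V W p)) \<and>
     (\<forall>V W W'. vector_field V \<longrightarrow> vector_field W \<longrightarrow> vector_field W' \<longrightarrow>
        (\<forall>p. D V (\<lambda>q. W q + W' q) p = D V W p + D V W' p)) \<and>
     (\<forall>f :: 'n M0 \<Rightarrow> real. \<forall>V W. smooth_M0 f \<longrightarrow> vector_field V \<longrightarrow> vector_field W \<longrightarrow>
        (\<forall>p. D V (\<lambda>q. f q *\<^sub>R W q) p = along V f p *\<^sub>R W p + f p *\<^sub>R D V W p))"

definition torsion_free :: "'n::finite conn \<Rightarrow> bool" where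
  "torsion_free D \<longleftrightarrow>
     (\<forall>V W. vector_field V \<longrightarrow> vector_field W \<longrightarrow>
        (\<forall>p. D V W p - D W V p = lie_bracket V W p))"

definition metric_connection ::
    "('n::finite M0 \<Rightarrow> 'n tangent \<Rightarrow> 'n tangent \<Rightarrow> real) \<Rightarrow> 'n conn \<Rightarrow> bool" where
  "metric_connection g D \<longleftrightarrow>
     (\<forall>U V W. vector_field U \<longrightarrow> vector_field V \<longrightarrow> vector_field W \<longrightarrow>
        (\<forall>p. along U (\<lambda>q. g q (V q) (W q)) p = g p (D U V p) (W p) + g p (V p) (D U W p)))"

definition is_levi_civita ::
    "('n::finite M0 \<Rightarrow> 'n tangent \<Rightarrow> 'n tangent \<Rightarrow> real) \<Rightarrow> 'n conn \<Rightarrow> bool" where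
  "is_levi_civita g D \<longleftrightarrow> affine_connection D \<and> torsion_free D \<and> metric_connection g D"

text \<open>For a Riemannian metric \<open>g\<close> the values of \<open>levi_civita g\<close> on vector fields are uniquely
  determined; its values on maps that are not vector fields are arbitrary, whence the
  indefinite description.\<close>

definition levi_civita ::
    "('n::finite M0 \<Rightarrow> 'n tangent \<Rightarrow> 'n tangent \<Rightarrow> real) \<Rightarrow> 'n conn" where
  "levi_civita g = (SOME D. is_levi_civita g D)"

definition cov_deriv_endo ::
    "'n::finite conn \<Rightarrow> ('n M0 \<Rightarrow> 'n tangent \<Rightarrow> 'n tangent) \<Rightarrow>
     ('n M0 \<Rightarrow> 'n tangent) \<Rightarrow> ('n M0 \<Rightarrow> 'n tangent) \<Rightarrow> 'n M0 \<Rightarrow> 'n tangent" where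
  "cov_deriv_endo D J V W p = D V (\<lambda>q. J q (W q)) p - J p (D V W p)"

definition parallel_endo ::
    "'n::finite conn \<Rightarrow> ('n M0 \<Rightarrow> 'n tangent \<Rightarrow> 'n tangent) \<Rightarrow> bool" where
  "parallel_endo D J \<longleftrightarrow>
     (\<forall>V W. vector_field V \<longrightarrow> vector_field W \<longrightarrow> (\<forall>p. cov_deriv_endo D J V W p = 0))"


section \<open>The Siegel upper half space and the structures defined by \<open>Z = X + \<i>Y\<close>\<close>

definition Re_mat :: "complex^'n^'m \<Rightarrow> real^'n^'m" where
  "Re_mat Z = (\<chi> i j. Re (Z $ i $ j))"

definition Im_mat :: "complex^'n^'m \<Rightarrow> real^'n^'m" where
  "Im_mat Z = (\<chi> i j. Im (Z $ i $ j))"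

definition of_real_mat :: "real^'n^'m \<Rightarrow> complex^'n^'m" where
  "of_real_mat A = (\<chi> i j. complex_of_real (A $ i $ j))"

definition siegel :: "(complex^'n^'n::finite) set" where
  "siegel = {Z. transpose Z = Z \<and> (\<forall>v. v \<noteq> 0 \<longrightarrow> v \<bullet> (Im_mat Z *v v) > 0)}"

definition acs :: "complex^'n^'n \<Rightarrow> 'n::finite tangent \<Rightarrow> 'n tangent" where
  "acs Z u =
     (let X = Re_mat Z; Y = Im_mat Z; Y' = matrix_inv Y; ux = fst u; uy = snd u in
       ((X ** Y') *v ux - (Y + X ** Y' ** X) *v uy,
        Y' *v ux - (Y' ** X) *v uy))"

definition Omega_mat :: "complex^'n^'n \<Rightarrow> complex^'n^'n::finite" where
  "Omega_mat Z =
     (let X = Re_mat Z; Y = Im_mat Z in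
       of_real_mat (matrix_inv (Y + X ** matrix_inv Y ** X)) ** Z ** of_real_mat (matrix_inv Y))"

definition partial ::
    "'n::finite \<Rightarrow> (real^'n \<Rightarrow> 'b::real_normed_vector) \<Rightarrow> real^'n \<Rightarrow> 'b" where
  "partial i f x = frechet_derivative f (at x) (axis i 1)"

definition integrable_point ::
    "nat \<Rightarrow> (real^'n \<Rightarrow> complex^'n^'n) \<Rightarrow> int^'n::finite \<Rightarrow> bool" where
  "integrable_point N \<Omega> m \<longleftrightarrow>
     (\<forall>x i j. let w = (\<chi> k. complex_of_real (of_int (m $ k) - of_nat N * x $ k)) in
        (partial i \<Omega> x *v w) $ j = (partial j \<Omega> x *v w) $ i)"

end

theory Submission
  imports Defs
begin

text \<open>Since \<open>Z\<close> is symmetric, \<open>(Y + X Y\<^sup>-\<^sup>1 X)\<^sup>-\<^sup>1 Z Y\<^sup>-\<^sup>1\<close> is the inverse of the complex conjugate of \<open>Z\<close>. So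
  \<open>\<Omega> = A + \<i>B\<close> is a symmetric matrix with \<open>B\<close> positive definite, and in terms of \<open>\<Omega>\<close> the almost
  complex structure is \<open>J(0, B t) = - (t, A t)\<close>.

  Every almost Kaehler structure is Kaehler exactly when its Nijenhuis tensor \<open>N\<close> vanishes. Indeed
  \<open>T(U; V, W) = g((\<nabla>\<^sub>U J) V, W)\<close> is the covariant derivative of \<open>\<omega>\<^sub>0\<close>: it is skew in \<open>V, W\<close>, its cyclic
  sum is \<open>d\<omega>\<^sub>0 = 0\<close>, and \<open>T(U; JV, W) = T(U; V, JW)\<close> because \<open>J\<^sup>2 = - 1\<close>. These three symmetries
  yield \<open>g(N(V, W), U) = - 2 T(U; JV, W)\<close> (\<open>g_nijenhuis\<close>, \<open>parallel_iff_nijenhuis\<close>). A Levi-Civita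
  connection exists because the Koszul formula can be solved with \<open>J\<close> in place of the inverse of the
  metric (\<open>is_levi_civita_lc_conn\<close>).

  It remains to compute \<open>N\<close>. It is antilinear in both arguments, hence determined by its values on the
  vertical fields \<open>F\<^sub>t = (0, B t)\<close>. As nothing depends on \<open>y\<close>, brackets of \<open>F\<^sub>s\<close> and \<open>J F\<^sub>s\<close> only involve
  derivatives in the direction of \<open>x\<close>, and
  \<open>N(F\<^sub>s, F\<^sub>t) = (0, A'(s) t - A'(t) s) + J (0, B'(s) t - B'(t) s)\<close> (\<open>nijenhuis_vertical\<close>). The two summands
  lie in complementary subspaces, so \<open>N = 0\<close> iff the derivatives of \<open>A\<close> and of \<open>B\<close> are symmetric in
  \<open>s, t\<close>; this is the closedness of the rows of \<open>\<Omega>\<close>.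

  Finally, integrability of a point \<open>m\<close> says that the closedness defect of \<open>\<Omega>\<close> annihilates the vector
  \<open>m - N x\<close>. If it does so for all \<open>m\<close>, it annihilates the differences of lattice points, among them
  the standard basis (\<open>integrable_iff_closed\<close>).\<close>

section \<open>Calculus of smooth maps\<close>

lemma C_k_SucI:
  assumes "\<And>x. (f has_derivative f' x) (at x)" "\<And>v. C_k k (\<lambda>x. f' x v)"
  shows "C_k (Suc k) f"
proof -
  have "frechet_derivative f (at x) = f' x" for x
    using frechet_derivative_at[OF assms(1)] by simp
  with assms show ?thesis by (auto simp: differentiable_def)
qed

lemma C_k_SucD: "C_k (Suc k) f \<Longrightarrow> C_k k f"
proof (induction k arbitrary: f)
  case 0
  then show ?case
    by (auto simp: continuous_on_eq_continuous_at intro: differentiable_imp_continuous_within)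
next
  case (Suc k)
  from Suc.prems have "f differentiable (at x)" "C_k (Suc k) (\<lambda>x. frechet_derivative f (at x) v)"
    for x v by simp_all
  with Suc.IH show ?case by simp
qed

lemma C_k_Suc_has_derivative:
  "C_k (Suc k) f \<Longrightarrow> (f has_derivative frechet_derivative f (at x)) (at x)"
  by (simp add: frechet_derivative_works)

lemma C_k_const: "C_k k (\<lambda>x. c)"
proof (induction k arbitrary: c)
  case (Suc k)
  show ?case by (rule C_k_SucI[where f' = "\<lambda>_ _. 0"]) (use Suc in auto)
qed simp

lemma C_k_add: "C_k k f \<Longrightarrow> C_k k g \<Longrightarrow> C_k k (\<lambda>x. f x + g x)"
proof (induction k arbitrary: f g)
  case (Suc k)
  show ?case
    by (rule C_k_SucI[OF has_derivative_add[OF Suc.prems[THEN C_k_Suc_has_derivative]]])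
       (use Suc in auto)
qed (simp add: continuous_on_add)

lemma C_k_bilinear:
  assumes "bounded_bilinear \<beta>"
  shows "C_k k f \<Longrightarrow> C_k k g \<Longrightarrow> C_k k (\<lambda>x. \<beta> (f x) (g x))"
proof (induction k arbitrary: f g)
  case 0
  then show ?case by (simp add: bounded_bilinear.continuous_on[OF assms])
next
  case (Suc k)
  show ?case
    by (rule C_k_SucI[OF bounded_bilinear.FDERIV[OF assms Suc.prems[THEN C_k_Suc_has_derivative]]])
       (use Suc in \<open>auto intro!: C_k_add Suc.IH dest: C_k_SucD simp del: C_k.simps(2)\<close>,
        use Suc in auto)
qed

lemma C_k_bounded_linear:
  assumes "bounded_linear h"
  shows "C_k k f \<Longrightarrow> C_k k (\<lambda>x. h (f x))"
proof (induction k arbitrary: f)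
  case 0
  then show ?case
    using bounded_linear.continuous_on[OF assms] by auto
next
  case (Suc k)
  show ?case
    by (rule C_k_SucI[OF bounded_linear.has_derivative[OF assms Suc.prems[THEN C_k_Suc_has_derivative]]])
       (use Suc in auto)
qed

lemma C_k_inverse:
  fixes f :: "'a::real_normed_vector \<Rightarrow> real"
  assumes "\<And>x. f x \<noteq> 0"
  shows "C_k k f \<Longrightarrow> C_k k (\<lambda>x. inverse (f x))"
proof (induction k)
  case 0
  then show ?case using assms by (auto intro: continuous_on_inverse)
next
  case (Suc k)
  have "((\<lambda>x. inverse (f x)) has_derivative
      (\<lambda>v. - (inverse (f x) * frechet_derivative f (at x) v * inverse (f x)))) (at x)" for x
    by (rule Deriv.has_derivative_inverse[OF assms C_k_Suc_has_derivative[OF Suc.prems]])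
  moreover have "C_k k (\<lambda>x. - (inverse (f x) * frechet_derivative f (at x) v * inverse (f x)))" for v
  proof -
    have "C_k k (\<lambda>x. inverse (f x))" "C_k k (\<lambda>x. frechet_derivative f (at x) v)"
      using Suc C_k_SucD by auto
    then show ?thesis
      by (intro C_k_bounded_linear[OF bounded_linear_minus[OF bounded_linear_ident]]
        C_k_bilinear[OF bounded_bilinear_mult])
  qed
  ultimately show ?case by (rule C_k_SucI)
qed

lemma smooth_frechet: "smooth f \<Longrightarrow> smooth (\<lambda>x. frechet_derivative f (at x) v)"
  unfolding smooth_def by (metis C_k.simps(2))

lemma smooth_has_derivative:
  "smooth f \<Longrightarrow> (f has_derivative frechet_derivative f (at x)) (at x)"
  unfolding smooth_def using C_k_Suc_has_derivative by blast

subsection \<open>Smooth maps on \<open>M\<^sub>0\<close>\<close>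

lemma smooth_M0_has_derivative:
  "smooth_M0 f \<Longrightarrow> (f has_derivative frechet_derivative f (at p)) (at p)"
  unfolding smooth_M0_def by (blast intro: smooth_has_derivative)

lemma smooth_M0_const: "smooth_M0 (\<lambda>p. c)"
  by (simp add: smooth_M0_def smooth_def C_k_const)

lemma smooth_M0_add: "smooth_M0 f \<Longrightarrow> smooth_M0 g \<Longrightarrow> smooth_M0 (\<lambda>p. f p + g p)"
  by (simp add: smooth_M0_def smooth_def C_k_add)

lemma smooth_M0_bilinear:
  "bounded_bilinear \<beta> \<Longrightarrow> smooth_M0 f \<Longrightarrow> smooth_M0 g \<Longrightarrow> smooth_M0 (\<lambda>p. \<beta> (f p) (g p))"
  by (simp add: smooth_M0_def smooth_def C_k_bilinear)

lemma smooth_M0_linear: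
  "bounded_linear h \<Longrightarrow> smooth_M0 f \<Longrightarrow> smooth_M0 (\<lambda>p. h (f p))"
  by (simp add: smooth_M0_def smooth_def C_k_bounded_linear)

lemma smooth_M0_inverse:
  fixes f :: "'n::finite M0 \<Rightarrow> real"
  shows "(\<And>p. f p \<noteq> 0) \<Longrightarrow> smooth_M0 f \<Longrightarrow> smooth_M0 (\<lambda>p. inverse (f p))"
  by (simp add: smooth_M0_def smooth_def C_k_inverse)

lemmas smooth_M0_scaleR = smooth_M0_bilinear[OF bounded_bilinear_scaleR]
lemmas smooth_M0_mult = smooth_M0_bilinear[OF bounded_bilinear_mult]
lemmas smooth_M0_uminus = smooth_M0_linear[OF bounded_linear_minus[OF bounded_linear_ident]]

lemma smooth_M0_diff: "smooth_M0 f \<Longrightarrow> smooth_M0 g \<Longrightarrow> smooth_M0 (\<lambda>p. f p - g p)"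
  using smooth_M0_add[OF _ smooth_M0_uminus, of f g] by simp

lemma smooth_M0_sum:
  "(\<And>i. i \<in> I \<Longrightarrow> smooth_M0 (f i)) \<Longrightarrow> smooth_M0 (\<lambda>p. \<Sum>i\<in>I. f i p)"
  by (induction I rule: infinite_finite_induct) (auto intro: smooth_M0_add smooth_M0_const)

lemma smooth_M0_prod:
  fixes f :: "'i \<Rightarrow> 'n::finite M0 \<Rightarrow> real"
  shows "(\<And>i. i \<in> I \<Longrightarrow> smooth_M0 (f i)) \<Longrightarrow> smooth_M0 (\<lambda>p. \<Prod>i\<in>I. f i p)"
  by (induction I rule: infinite_finite_induct) (auto intro: smooth_M0_mult smooth_M0_const)

lemma smooth_M0_Pair: 
  assumes "smooth_M0 f" "smooth_M0 g" shows "smooth_M0 (\<lambda>p. (f p, g p))"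
proof -
  have "bounded_linear (\<lambda>u. (u, 0))" "bounded_linear (\<lambda>v. (0, v))"
    by (auto intro: bounded_linear_Pair bounded_linear_ident bounded_linear_zero)
  from smooth_M0_add[OF this[THEN smooth_M0_linear] ] assms 
  show ?thesis by fastforce
qed

text \<open>The difference quotient at a translated point is the difference quotient of the translated map.\<close>

lemma frechet_derivative_periodic:
  assumes "\<And>p. f (p + c) = f p" and "f differentiable (at p)"
  shows "frechet_derivative f (at (p + c)) = frechet_derivative f (at p)"
proof -
  have "(f has_derivative frechet_derivative f (at p)) (at (p + c + - c))"
    using assms(2) by (simp add: frechet_derivative_works)
  moreover have "((\<lambda>q. q + - c) has_derivative (\<lambda>v. v)) (at (p + c))"
    by (auto intro!: derivative_eq_intros)
  ultimately have "((\<lambda>q. f (q + - c)) has_derivative frechet_derivative f (at p)) (at (p + c))"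
    using has_derivative_compose by fastforce
  moreover have "f (q + - c) = f q" for q
    using assms(1)[of "q + - c"] by simp
  ultimately show ?thesis
    using frechet_derivative_at by fastforce
qed

lemma smooth_M0_frechet:
  fixes f :: "'n::finite M0 \<Rightarrow> 'b::real_normed_vector"
  assumes "smooth_M0 f" shows "smooth_M0 (\<lambda>p. frechet_derivative f (at p) v)"
proof -
  have "frechet_derivative f (at (x, y + m)) = frechet_derivative f (at (x, y))"
    if "\<And>x y. f (x, y + m) = f (x, y)" for x y and m :: "real^'n"
  proof -
    have "f differentiable (at (x, y))"
      using smooth_M0_has_derivative[OF assms] by (rule differentiableI)
    with frechet_derivative_periodic[of f "(0, m)" "(x, y)"] that show ?thesis by auto
  qed
  with assms show ?thesis
    by (auto simp: smooth_M0_def smooth_frechet)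
qed

lemma smooth_M0_along:
  assumes "vector_field V" "smooth_M0 f" shows "smooth_M0 (along V f)"
proof -
  have lin: "linear (frechet_derivative f (at p))" for p
    using smooth_M0_has_derivative[OF assms(2)] has_derivative_linear by blast
  have "along V f = (\<lambda>p. \<Sum>b\<in>Basis. (V p \<bullet> b) *\<^sub>R frechet_derivative f (at p) b)"
  proof
    fix p
    have "along V f p = frechet_derivative f (at p) (\<Sum>b\<in>Basis. (V p \<bullet> b) *\<^sub>R b)"
      by (simp add: along_def euclidean_representation)
    then show "along V f p = (\<Sum>b\<in>Basis. (V p \<bullet> b) *\<^sub>R frechet_derivative f (at p) b)"
      by (simp add: linear_sum[OF lin] linear_cmul[OF lin])
  qed
  then show ?thesis
    by (auto intro!: smooth_M0_sum smooth_M0_scaleR smooth_M0_frechet assms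
        smooth_M0_linear[OF bounded_linear_inner_left])
qed


lemma along_add_left:
  "smooth_M0 f \<Longrightarrow> along (\<lambda>q. V q + V' q) f p = along V f p + along V' f p"
  by (simp add: along_def linear_add[OF has_derivative_linear[OF smooth_M0_has_derivative]])

lemma along_scaleR_left:
  "smooth_M0 f \<Longrightarrow> along (\<lambda>q. c q *\<^sub>R V q) f p = c p *\<^sub>R along V f p"
  by (simp add: along_def linear_cmul[OF has_derivative_linear[OF smooth_M0_has_derivative]])

lemma along_eqI: "(f has_derivative f') (at p) \<Longrightarrow> along V f p = f' (V p)"
  unfolding along_def by (simp add: frechet_derivative_at[symmetric])

lemma along_bilinear:
  assumes "bounded_bilinear \<beta>" "smooth_M0 f" "smooth_M0 h"
  shows "along V (\<lambda>q. \<beta> (f q) (h q)) p = \<beta> (f p) (along V h p) + \<beta> (along V f p) (h p)"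
  using along_eqI[OF bounded_bilinear.FDERIV[OF assms(1) assms(2,3)[THEN smooth_M0_has_derivative]]]
  by (simp add: along_def)

lemma along_add_right:
  assumes "smooth_M0 f" "smooth_M0 h"
  shows "along V (\<lambda>q. f q + h q) p = along V f p + along V h p"
  using along_eqI[OF has_derivative_add[OF assms[THEN smooth_M0_has_derivative]]]
  by (simp add: along_def)

section \<open>Compatible almost complex structures\<close>

lemma bounded_bilinear_omega0: "bounded_bilinear omega0"
proof -
  have eq: "omega0 = (\<lambda>u v. fst u \<bullet> snd v - snd u \<bullet> fst v)"
    by (simp add: fun_eq_iff omega0_def inner_vec_def sum_subtractf)
  show ?thesis
    unfolding eq bilinear_conv_bounded_bilinear[symmetric] bilinear_def
    by (auto intro!: linearI simp: inner_simps algebra_simps)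
qed

interpretation omega0: bounded_bilinear omega0
  by (rule bounded_bilinear_omega0)

lemma omega0_skew: "omega0 u v = - omega0 v u"
  by (simp add: omega0_def sum_negf[symmetric] algebra_simps)

text \<open>The quarter turn \<open>(x, y) \<mapsto> (- y, x)\<close> converts \<open>\<omega>\<^sub>0\<close> into the Euclidean inner product; it serves to
  represent a covector as \<open>\<omega>\<^sub>0(\<cdot>, t)\<close>.\<close>

definition quarter_turn :: "'n::finite tangent \<Rightarrow> 'n tangent" where
  "quarter_turn v = (- snd v, fst v)"

lemma omega0_quarter_turn: "omega0 u (quarter_turn v) = u \<bullet> v"
  by (simp add: omega0_def quarter_turn_def inner_prod_def inner_vec_def sum.distrib)

lemma omega0_represent:
  assumes "linear \<alpha>"
  shows "omega0 w (\<Sum>b\<in>Basis. \<alpha> b *\<^sub>R quarter_turn b) = \<alpha> w"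
proof -
  have "\<alpha> (\<Sum>b\<in>Basis. (w \<bullet> b) *\<^sub>R b) = (\<Sum>b\<in>Basis. (w \<bullet> b) * \<alpha> b)"
    by (simp add: linear_sum[OF assms] linear_cmul[OF assms])
  then show ?thesis
    by (simp add: omega0.sum_right omega0.scaleR_right omega0_quarter_turn euclidean_representation
        mult.commute)
qed

text \<open>The relation between \<open>\<nabla>J\<close> and the Nijenhuis tensor holds for every almost Kaehler structure
  \<open>(\<omega>\<^sub>0, J)\<close> on \<open>M\<^sub>0\<close>, hence this locale instead of a map to the Siegel upper half space.\<close>

locale compatible_acs =
  fixes J :: "'n::finite M0 \<Rightarrow> 'n tangent \<Rightarrow> 'n tangent"
  assumes linear_J: "linear (J p)"
    and J_J: "J p (J p v) = - v"
    and omega0_J_sym: "omega0 u (J p v) = omega0 v (J p u)"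
    and omega0_J_pos: "u \<noteq> 0 \<Longrightarrow> omega0 u (J p u) > 0"
    and smooth_J: "smooth_M0 (\<lambda>p. J p u)"
begin

abbreviation g :: "'n M0 \<Rightarrow> 'n tangent \<Rightarrow> 'n tangent \<Rightarrow> real" where
  "g p u v \<equiv> omega0 u (J p v)"

abbreviation J_field :: "('n M0 \<Rightarrow> 'n tangent) \<Rightarrow> 'n M0 \<Rightarrow> 'n tangent" where
  "J_field W \<equiv> \<lambda>q. J q (W q)"

definition dJ :: "'n M0 \<Rightarrow> 'n tangent \<Rightarrow> 'n tangent \<Rightarrow> 'n tangent" where
  "dJ p v w = frechet_derivative (\<lambda>q. J q w) (at p) v"

lemmas J_add = linear_add[OF linear_J]
  and J_diff = linear_diff[OF linear_J]
  and J_neg = linear_neg[OF linear_J]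
  and J_scaleR = linear_cmul[OF linear_J]
  and J_zero = linear_0[OF linear_J]
lemmas J_linear_simps = J_add J_diff J_neg J_scaleR J_zero

lemma J_eq_0_iff: "J p v = 0 \<longleftrightarrow> v = 0"
  using J_J[of p v] J_zero[of p] by fastforce

lemma J_field_expand: "J q w = (\<Sum>b\<in>Basis. (w \<bullet> b) *\<^sub>R J q b)"
  by (subst euclidean_representation[of w, symmetric])
     (simp only: linear_sum[OF linear_J] linear_cmul[OF linear_J])

lemma smooth_J_field:
  assumes "vector_field W" shows "vector_field (J_field W)"
  by (subst J_field_expand)
     (intro smooth_M0_sum smooth_M0_scaleR smooth_J assms smooth_M0_linear[OF bounded_linear_inner_left])

lemma has_derivative_J: "((\<lambda>q. J q w) has_derivative (\<lambda>v. dJ p v w)) (at p)"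
  unfolding dJ_def using smooth_M0_has_derivative[OF smooth_J] .

lemma linear_dJ_left: "linear (\<lambda>v. dJ p v w)"
  using has_derivative_J has_derivative_linear by blast

lemma dJ_expand: "dJ p v w = (\<Sum>b\<in>Basis. (w \<bullet> b) *\<^sub>R dJ p v b)"
proof -
  have "((\<lambda>q. \<Sum>b\<in>Basis. (w \<bullet> b) *\<^sub>R J q b) has_derivative
      (\<lambda>v. \<Sum>b\<in>Basis. (w \<bullet> b) *\<^sub>R dJ p v b)) (at p)"
    by (intro has_derivative_sum has_derivative_scaleR_right has_derivative_J)
  then show ?thesis
    unfolding J_field_expand[symmetric]
    using has_derivative_unique[OF has_derivative_J] by (metis (lifting))
qed

lemma linear_dJ_right: "linear (dJ p v)"
proof -
  have "linear (\<lambda>w. \<Sum>b\<in>Basis. (w \<bullet> b) *\<^sub>R dJ p v b)"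
    by (intro linear_compose_sum ballI linearI) (simp_all add: inner_add_left scaleR_add_left)
  moreover have "dJ p v = (\<lambda>w. \<Sum>b\<in>Basis. (w \<bullet> b) *\<^sub>R dJ p v b)"
    using dJ_expand by (rule ext)
  ultimately show ?thesis by (rule ssubst[rotated])
qed

lemma has_derivative_J_field:
  assumes "(W has_derivative W') (at p)"
  shows "((\<lambda>q. J q (W q)) has_derivative (\<lambda>v. dJ p v (W p) + J p (W' v))) (at p)"
proof -
  have "((\<lambda>q. \<Sum>b\<in>Basis. (W q \<bullet> b) *\<^sub>R J q b) has_derivative
      (\<lambda>v. \<Sum>b\<in>Basis. (W p \<bullet> b) *\<^sub>R dJ p v b + (W' v \<bullet> b) *\<^sub>R J p b)) (at p)"
    by (intro has_derivative_sum has_derivative_scaleR has_derivative_inner_left has_derivative_J assms)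
  then show ?thesis
    unfolding J_field_expand[symmetric] sum.distrib dJ_expand[symmetric] .
qed

lemma along_J_field:
  assumes "vector_field W"
  shows "along V (J_field W) p = dJ p (V p) (W p) + J p (along V W p)"
  using along_eqI[OF has_derivative_J_field[OF smooth_M0_has_derivative[OF assms]]]
  by (simp add: along_def)

lemma dJ_J: "dJ p v (J p w) = - J p (dJ p v w)"
proof -
  have "((\<lambda>q. J q (J q w)) has_derivative (\<lambda>v. dJ p v (J p w) + J p (dJ p v w))) (at p)"
    by (intro has_derivative_J_field has_derivative_J)
  moreover have "((\<lambda>q. J q (J q w)) has_derivative (\<lambda>v. 0)) (at p)"
    by (simp add: J_J)
  ultimately have "(\<lambda>v. dJ p v (J p w) + J p (dJ p v w)) = (\<lambda>v. 0)"
    by (rule has_derivative_unique)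
  then have "dJ p v (J p w) + J p (dJ p v w) = 0" by (rule fun_cong)
  then show ?thesis by (simp add: eq_neg_iff_add_eq_0)
qed

lemma omega0_dJ_sym: "omega0 u (dJ p v w) = omega0 w (dJ p v u)"
proof -
  have "((\<lambda>q. omega0 u (J q w)) has_derivative (\<lambda>v. omega0 u (dJ p v w))) (at p)" for u w
    by (intro bounded_linear.has_derivative[OF omega0.bounded_linear_right] has_derivative_J)
  from has_derivative_unique[OF this[of u w, unfolded omega0_J_sym[of u _ w]] this[of w u]]
  show ?thesis by (rule fun_cong)
qed

lemmas dJ_linear_simps =
  linear_add[OF linear_dJ_left] linear_diff[OF linear_dJ_left] linear_neg[OF linear_dJ_left]
  linear_cmul[OF linear_dJ_left]
  linear_add[OF linear_dJ_right] linear_diff[OF linear_dJ_right] linear_neg[OF linear_dJ_right]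
  linear_cmul[OF linear_dJ_right]

lemma g_J_left: "g p (J p u) v = omega0 u v"
  by (metis J_J omega0_J_sym omega0.minus_right omega0_skew)

subsection \<open>The Levi-Civita connection\<close>

text \<open>The Koszul formula prescribes \<open>2 g(w, \<Gamma>(u, v))\<close> in terms of \<open>dg = \<omega>\<^sub>0(\<cdot>, dJ \<cdot>)\<close>. Writing
  \<open>g(w, z) = \<omega>\<^sub>0(w, J z)\<close>, the solution is obtained by representing its right hand side as
  \<open>\<omega>\<^sub>0(w, t)\<close> and setting \<open>2 \<Gamma>(u, v) = - J t\<close>. No inverse of the metric occurs, so that \<open>\<Gamma>\<close> is
  visibly smooth.\<close>

definition christoffel :: "'n M0 \<Rightarrow> 'n tangent \<Rightarrow> 'n tangent \<Rightarrow> 'n tangent" where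
  "christoffel p u v = (1/2) *\<^sub>R J p
     ((\<Sum>b\<in>Basis. omega0 u (dJ p b v) *\<^sub>R quarter_turn b) - dJ p u v - dJ p v u)"

definition lc_conn :: "'n conn" where
  "lc_conn V W p = along V W p + christoffel p (V p) (W p)"

lemma koszul:
  "2 * g p w (christoffel p u v) = omega0 w (dJ p u v) + omega0 w (dJ p v u) - omega0 u (dJ p w v)"
proof -
  have "linear (\<lambda>w. omega0 u (dJ p w v))"
    by (intro linearI) (simp_all add: dJ_linear_simps omega0.add_right omega0.scaleR_right)
  from omega0_represent[OF this, of w] show ?thesis
    by (simp add: christoffel_def J_linear_simps J_J omega0.add_right omega0.diff_right
        omega0.scaleR_right omega0.minus_right)
qed

lemma christoffel_sym: "christoffel p u v = christoffel p v u"
  by (simp add: christoffel_def omega0_dJ_sym[of u _ _ v] algebra_simps)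

lemma linear_christoffel: "linear (christoffel p u)"
proof -
  have "linear (\<lambda>v. \<Sum>b\<in>Basis. omega0 u (dJ p b v) *\<^sub>R quarter_turn b)"
    by (intro linear_compose_sum ballI linearI)
       (simp_all add: dJ_linear_simps omega0.add_right omega0.scaleR_right algebra_simps)
  then have "linear (\<lambda>v. (\<Sum>b\<in>Basis. omega0 u (dJ p b v) *\<^sub>R quarter_turn b) - dJ p u v - dJ p v u)"
    by (intro linear_compose_sub linear_dJ_left linear_dJ_right)
  from linear_compose_scale_right[OF linear_compose[OF this linear_J]] show ?thesis
    by (simp add: christoffel_def[abs_def] o_def)
qed

text \<open>The expression \<open>dJ(V) W\<close> is smooth because it is the commutator of \<open>J\<close> with the flat
  derivative along \<open>V\<close>.\<close>

lemma smooth_lc_conn: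
  assumes V: "vector_field V" and W: "vector_field W"
  shows "vector_field (lc_conn V W)"
proof -
  have dJ: "smooth_M0 (\<lambda>p. dJ p (V p) (W p))" if "vector_field V" "vector_field W" for V W
  proof -
    have "(\<lambda>p. dJ p (V p) (W p)) = (\<lambda>p. along V (J_field W) p - J p (along V W p))"
      using along_J_field[OF that(2)] by auto
    then show ?thesis
      using smooth_M0_diff[OF smooth_M0_along[OF that(1) smooth_J_field[OF that(2)]]
          smooth_J_field[OF smooth_M0_along[OF that]]] by simp
  qed
  have "vector_field (\<lambda>p. (1/2) *\<^sub>R J p
      ((\<Sum>b\<in>Basis. omega0 (V p) (dJ p b (W p)) *\<^sub>R quarter_turn b)
        - dJ p (V p) (W p) - dJ p (W p) (V p)))"
    by (intro smooth_M0_scaleR smooth_M0_const smooth_J_field smooth_M0_diff smooth_M0_sum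
        smooth_M0_bilinear[OF bounded_bilinear_omega0] V W dJ)
  then have "vector_field (\<lambda>p. christoffel p (V p) (W p))"
    by (simp add: christoffel_def)
  then show ?thesis
    using smooth_M0_add[OF smooth_M0_along[OF V W]] by (simp add: lc_conn_def[abs_def])
qed

lemma is_levi_civita_lc_conn: "is_levi_civita g lc_conn"
proof -
  have lin_right: "linear (\<lambda>u. christoffel p u v)" for p v
    using linear_christoffel[of p v] by (subst christoffel_sym)
  have "affine_connection lc_conn"
    unfolding affine_connection_def
    by (auto simp: smooth_lc_conn lc_conn_def along_add_left along_scaleR_left along_add_right
        along_bilinear[OF bounded_bilinear_scaleR]
        linear_add[OF lin_right] linear_cmul[OF lin_right] linear_add[OF linear_christoffel]
        linear_cmul[OF linear_christoffel] algebra_simps)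
  moreover have "torsion_free lc_conn"
    unfolding torsion_free_def lc_conn_def lie_bracket_def using christoffel_sym by auto
  moreover have "metric_connection g lc_conn"
    unfolding metric_connection_def
  proof (intro allI impI)
    fix U V W :: "'n M0 \<Rightarrow> 'n tangent" and p
    assume U: "vector_field U" and V: "vector_field V" and W: "vector_field W"
    have "along U (\<lambda>q. g q (V q) (W q)) p =
        omega0 (V p) (dJ p (U p) (W p)) + g p (V p) (along U W p) + g p (along U V p) (W p)"
      by (simp add: along_bilinear[OF bounded_bilinear_omega0 V smooth_J_field[OF W]]
          along_J_field[OF W] omega0.add_right)
    moreover have "omega0 (V p) (dJ p (U p) (W p)) =
        g p (christoffel p (U p) (V p)) (W p) + g p (V p) (christoffel p (U p) (W p))"
      using koszul[of "W p" p "U p" "V p"] koszul[of "V p" p "U p" "W p"]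
        omega0_dJ_sym[of "W p" p "U p" "V p"] omega0_dJ_sym[of "U p" p "W p" "V p"]
        omega0_dJ_sym[of "U p" p "V p" "W p"] omega0_J_sym[of "W p" p]
      by simp
    ultimately show "along U (\<lambda>q. g q (V q) (W q)) p =
        g p (lc_conn U V p) (W p) + g p (V p) (lc_conn U W p)"
      by (simp add: lc_conn_def J_add omega0.add_right omega0.add_left)
  qed
  ultimately show ?thesis by (simp add: is_levi_civita_def)
qed

lemma is_levi_civita_levi_civita: "is_levi_civita g (levi_civita g)"
  unfolding levi_civita_def using is_levi_civita_lc_conn by (rule someI[where P = "is_levi_civita g"])

subsection \<open>The Nijenhuis tensor\<close>

definition nijenhuis ::
    "('n M0 \<Rightarrow> 'n tangent) \<Rightarrow> ('n M0 \<Rightarrow> 'n tangent) \<Rightarrow> 'n M0 \<Rightarrow> 'n tangent" where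
  "nijenhuis V W p = lie_bracket (J_field V) (J_field W) p - J p (lie_bracket (J_field V) W p)
     - J p (lie_bracket V (J_field W) p) - lie_bracket V W p"

definition nijenhuis_at :: "'n M0 \<Rightarrow> 'n tangent \<Rightarrow> 'n tangent \<Rightarrow> 'n tangent" where
  "nijenhuis_at p v w = dJ p (J p v) w - dJ p (J p w) v + J p (dJ p w v) - J p (dJ p v w)"

lemma nijenhuis_tensorial:
  assumes "vector_field V" "vector_field W"
  shows "nijenhuis V W p = nijenhuis_at p (V p) (W p)"
  using assms
  by (simp add: nijenhuis_def nijenhuis_at_def lie_bracket_def along_J_field J_linear_simps J_J)

lemma nijenhuis_at_skew: "nijenhuis_at p v w = - nijenhuis_at p w v"
  by (simp add: nijenhuis_at_def)

lemma nijenhuis_at_add: "nijenhuis_at p (v + v') w = nijenhuis_at p v w + nijenhuis_at p v' w"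
  by (simp add: nijenhuis_at_def dJ_linear_simps J_linear_simps)

lemma nijenhuis_at_J: "nijenhuis_at p (J p v) w = - J p (nijenhuis_at p v w)"
  by (simp add: nijenhuis_at_def dJ_linear_simps J_linear_simps J_J dJ_J)

text \<open>The Nijenhuis tensor is antilinear in each argument, so it vanishes as soon as it vanishes on a
  set that together with its image under \<open>J\<close> exhausts the tangent space.\<close>

lemma nijenhuis_at_eq_0I:
  assumes "\<And>s t. s \<in> S \<Longrightarrow> t \<in> S \<Longrightarrow> nijenhuis_at p s t = 0"
    and "\<And>v. \<exists>s\<in>S. \<exists>t\<in>S. v = s + J p t"
  shows "nijenhuis_at p v w = 0"
proof -
  have left: "nijenhuis_at p v t = 0" if "\<And>s. s \<in> S \<Longrightarrow> nijenhuis_at p s t = 0" for v t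
    using assms(2)[of v] that by (auto simp: nijenhuis_at_add nijenhuis_at_J J_zero)
  have "nijenhuis_at p s w = 0" if "s \<in> S" for s
    using assms(1) that left[of s w] nijenhuis_at_skew[of p s w] by simp
  then show ?thesis
    by (rule left)
qed

context
  fixes D :: "'n conn"
  assumes lc: "is_levi_civita g D"
begin

abbreviation DJ :: "('n M0 \<Rightarrow> 'n tangent) \<Rightarrow> ('n M0 \<Rightarrow> 'n tangent) \<Rightarrow> 'n M0 \<Rightarrow> 'n tangent" where
  "DJ \<equiv> cov_deriv_endo D J"

lemma D_torsion:
  "vector_field V \<Longrightarrow> vector_field W \<Longrightarrow> lie_bracket V W p = D V W p - D W V p"
  using lc unfolding is_levi_civita_def torsion_free_def by metis

lemma D_metric:
  "vector_field U \<Longrightarrow> vector_field V \<Longrightarrow> vector_field W \<Longrightarrow>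
    along U (\<lambda>q. g q (V q) (W q)) p = g p (D U V p) (W p) + g p (V p) (D U W p)"
  using lc unfolding is_levi_civita_def metric_connection_def by blast

lemma D_uminus:
  assumes "vector_field V" "vector_field W"
  shows "D V (\<lambda>q. - W q) p = - D V W p"
proof -
  (* the Leibniz rule for the constant function -1 stands in for real homogeneity *)
  have "D V (\<lambda>q. (-1) *\<^sub>R W q) p = along V (\<lambda>_. -1 :: real) p *\<^sub>R W p + (-1) *\<^sub>R D V W p"
    using lc assms smooth_M0_const[of "-1 :: real"]
    unfolding is_levi_civita_def affine_connection_def by blast
  moreover have "along V (\<lambda>_. -1 :: real) p = 0"
    by (simp add: along_def)
  ultimately show ?thesis by simp
qed

lemma DJ_J:
  assumes "vector_field U" "vector_field V"
  shows "DJ U (J_field V) p = - J p (DJ U V p)"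
  using D_uminus[OF assms] by (simp add: cov_deriv_endo_def J_J J_linear_simps)

text \<open>Since \<open>\<omega>\<^sub>0 = g(J\<cdot>, \<cdot>)\<close>, the tensor \<open>g((\<nabla>\<^sub>U J) V, W)\<close> is the covariant derivative of \<open>\<omega>\<^sub>0\<close>.\<close>

lemma g_DJ:
  assumes "vector_field U" "vector_field V" "vector_field W"
  shows "g p (DJ U V p) (W p) =
    along U (\<lambda>q. omega0 (V q) (W q)) p - omega0 (D U V p) (W p) - omega0 (V p) (D U W p)"
  using D_metric[OF assms(1) smooth_J_field[OF assms(2)] assms(3), of p]
  by (simp add: g_J_left cov_deriv_endo_def omega0.diff_left)

lemma g_DJ_skew:
  assumes "vector_field U" "vector_field V" "vector_field W"
  shows "g p (DJ U V p) (W p) = - g p (DJ U W p) (V p)"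
proof -
  have "along U (\<lambda>q. omega0 (V q) (W q)) p = - along U (\<lambda>q. omega0 (W q) (V q)) p"
    using assms omega0_skew[of "along U V p" "W p"] omega0_skew[of "V p" "along U W p"]
    by (simp add: along_bilinear[OF bounded_bilinear_omega0])
  then show ?thesis
    using assms omega0_skew[of "D U V p" "W p"] omega0_skew[of "V p" "D U W p"] by (simp add: g_DJ)
qed

text \<open>This is \<open>d\<omega>\<^sub>0 = 0\<close>: the cyclic sum of \<open>\<nabla>\<omega>\<^sub>0\<close> is the exterior derivative because the torsion vanishes.\<close>

lemma g_DJ_cyclic:
  assumes U: "vector_field U" and V: "vector_field V" and W: "vector_field W"
  shows "g p (DJ U V p) (W p) + g p (DJ V W p) (U p) + g p (DJ W U p) (V p) = 0"
proof -
  (* the difference to the flat connection is symmetric, and omega_0 is parallel for the latter *)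
  define d where "d A B = D A B p - along A B p" for A B
  have sym: "d A B = d B A" if "vector_field A" "vector_field B" for A B
    using D_torsion[OF that, of p] by (simp add: d_def lie_bracket_def algebra_simps)
  have "g p (DJ A B p) (C p) = - omega0 (d A B) (C p) + omega0 (d A C) (B p)"
    if "vector_field A" "vector_field B" "vector_field C" for A B C
    using that omega0_skew[of "B p" "d A C"]
    by (simp add: g_DJ along_bilinear[OF bounded_bilinear_omega0] d_def
        omega0.diff_left omega0.diff_right)
  with assms show ?thesis
    by (simp add: sym[OF V U] sym[OF W V] sym[OF W U])
qed

lemma g_DJ_J:
  assumes "vector_field U" "vector_field V" "vector_field W"
  shows "g p (DJ U (J_field V) p) (W p) = g p (DJ U V p) (J p (W p))"
  using assms omega0_J_sym[of "J p _"]
  by (simp add: DJ_J omega0.minus_left g_J_left J_J omega0.minus_right)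

lemma nijenhuis_DJ:
  assumes "vector_field V" "vector_field W"
  shows "nijenhuis V W p =
    DJ (J_field V) W p - DJ (J_field W) V p + J p (DJ W V p) - J p (DJ V W p)"
  using assms D_torsion[OF assms] D_torsion[OF assms[THEN smooth_J_field]]
    D_torsion[OF assms(1) smooth_J_field[OF assms(2)]]
    D_torsion[OF smooth_J_field[OF assms(1)] assms(2)]
  by (simp add: nijenhuis_def cov_deriv_endo_def J_linear_simps J_J)

text \<open>Expressed through \<open>T(U; V, W) = g((\<nabla>\<^sub>U J) V, W)\<close>, the left hand side consists of four terms in which
  \<open>U\<close> is not the direction of differentiation. The cyclic identities for \<open>(JV, W, U)\<close> and \<open>(JW, V, U)\<close>
  move \<open>U\<close> into that place; by skew-symmetry and by \<open>T(U; JV, W) = T(U; V, JW)\<close> all else cancels.\<close>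

lemma g_nijenhuis:
  assumes U: "vector_field U" and V: "vector_field V" and W: "vector_field W"
  shows "g p (nijenhuis V W p) (U p) = - 2 * g p (DJ U (J_field V) p) (W p)"
proof -
  note J = smooth_J_field[OF U] smooth_J_field[OF V] smooth_J_field[OF W]
  have "g p (nijenhuis V W p) (U p) = g p (DJ (J_field V) W p) (U p)
      - g p (DJ (J_field W) V p) (U p) - g p (DJ W V p) (J p (U p)) + g p (DJ V W p) (J p (U p))"
    using DJ_J[OF W V, of p] DJ_J[OF V W, of p] g_DJ_J[OF W V U, of p] g_DJ_J[OF V W U, of p]
    by (simp add: nijenhuis_DJ[OF V W] omega0.add_left omega0.diff_left omega0.minus_left)
  also have "\<dots> = - 2 * g p (DJ U (J_field V) p) (W p)"
    using g_DJ_cyclic[OF J(2) W U, of p] g_DJ_cyclic[OF J(3) V U, of p]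
      g_DJ_skew[OF W U J(2), of p] g_DJ_skew[OF V U J(3), of p]
      g_DJ_J[OF W V U, of p] g_DJ_J[OF V W U, of p] g_DJ_J[OF U V W, of p]
      g_DJ_skew[OF U J(3) V, of p]
    by linarith
  finally show ?thesis .
qed

text \<open>While \<open>nijenhuis_DJ\<close> expresses \<open>N\<close> through \<open>\<nabla>J\<close>, the identity \<open>g_nijenhuis\<close> recovers \<open>\<nabla>J\<close> from \<open>N\<close>,
  because \<open>g\<close> is definite.\<close>

theorem parallel_iff_nijenhuis:
  "parallel_endo D J \<longleftrightarrow>
    (\<forall>V W. vector_field V \<longrightarrow> vector_field W \<longrightarrow> (\<forall>p. nijenhuis V W p = 0))"
proof (intro iffI allI impI)
  fix V W :: "'n M0 \<Rightarrow> 'n tangent" and p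
  assume "parallel_endo D J" and VW: "vector_field V" "vector_field W"
  then have "DJ A B p = 0" if "vector_field A" "vector_field B" for A B
    using that unfolding parallel_endo_def by blast
  with VW show "nijenhuis V W p = 0"
    by (simp add: nijenhuis_DJ smooth_J_field J_zero)
next
  assume N: "\<forall>V W. vector_field V \<longrightarrow> vector_field W \<longrightarrow> (\<forall>p. nijenhuis V W p = 0)"
  show "parallel_endo D J"
    unfolding parallel_endo_def
  proof (intro allI impI)
    fix U V :: "'n M0 \<Rightarrow> 'n tangent" and p
    assume U: "vector_field U" and V: "vector_field V"
    let ?k = "DJ U (J_field V) p"
    have "nijenhuis V (\<lambda>_. ?k) p = 0"
      using N V smooth_M0_const by blast
    then have "g p ?k ?k = 0"
      using g_nijenhuis[OF U V smooth_M0_const[of ?k], of p] by (simp add: omega0.zero_left)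
    then have "?k = 0"
      using omega0_J_pos[of ?k p] by force
    then show "DJ U V p = 0"
      by (simp add: DJ_J[OF U V] J_eq_0_iff)
  qed
qed

end

end

section \<open>Smooth matrix-valued maps\<close>

lemma smooth_M0_nth: "smooth_M0 f \<Longrightarrow> smooth_M0 (\<lambda>p. f p $ i)"
  by (rule smooth_M0_linear[OF bounded_linear_vec_nth])

lemma smooth_M0_vecI:
  fixes f :: "'n::finite M0 \<Rightarrow> 'b::euclidean_space ^ 'm::finite"
  assumes "\<And>i. smooth_M0 (\<lambda>p. f p $ i)"
  shows "smooth_M0 f"
proof -
  have "linear (axis i :: 'b \<Rightarrow> 'b ^ 'm)" for i
    by (intro linearI) (simp_all add: axis_def vec_eq_iff)
  then have "smooth_M0 (\<lambda>p. \<Sum>i\<in>UNIV. axis i (f p $ i))"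
    by (intro smooth_M0_sum smooth_M0_linear[OF _ assms]) (simp add: linear_conv_bounded_linear)
  moreover have "(\<Sum>i\<in>UNIV. axis i (f p $ i)) = f p" for p
    by (simp add: vec_eq_iff axis_def)
  ultimately show ?thesis by simp
qed

lemma smooth_M0_matrix_mult:
  fixes A :: "'n::finite M0 \<Rightarrow> real^'a^'b" and B :: "'n M0 \<Rightarrow> real^'c^'a"
  assumes "smooth_M0 A" "smooth_M0 B"
  shows "smooth_M0 (\<lambda>p. A p ** B p)"
  by (intro smooth_M0_vecI)
     (auto simp: matrix_matrix_mult_def intro!: smooth_M0_sum smooth_M0_mult smooth_M0_nth assms)

lemma smooth_M0_matrix_vector_mult:
  fixes A :: "'n::finite M0 \<Rightarrow> real^'a^'b"
  assumes "smooth_M0 A" "smooth_M0 v"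
  shows "smooth_M0 (\<lambda>p. A p *v v p)"
  by (intro smooth_M0_vecI)
     (auto simp: matrix_vector_mult_def intro!: smooth_M0_sum smooth_M0_mult smooth_M0_nth assms)

lemma smooth_M0_det:
  fixes A :: "'n::finite M0 \<Rightarrow> real^'m^'m"
  assumes "smooth_M0 A"
  shows "smooth_M0 (\<lambda>p. det (A p))"
  unfolding det_def
  by (intro smooth_M0_sum smooth_M0_mult smooth_M0_const smooth_M0_prod smooth_M0_nth assms)

lemma matrix_inv_works:
  fixes A :: "'a::semiring_1^'n^'m"
  assumes "invertible A"
  shows "A ** matrix_inv A = mat 1" "matrix_inv A ** A = mat 1"
  using someI_ex[OF assms[unfolded invertible_def]] unfolding matrix_inv_def by blast+

lemma matrix_inv_mult_vector:
  fixes A :: "'a::comm_semiring_1^'n^'n"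
  assumes "invertible A"
  shows "A *v (matrix_inv A *v v) = v" "matrix_inv A *v (A *v v) = v"
  by (simp_all add: matrix_vector_mul_assoc matrix_inv_works[OF assms])

text \<open>By Cramer's rule the entries of the inverse are quotients of determinants.\<close>

lemma smooth_M0_matrix_inv:
  fixes A :: "'n::finite M0 \<Rightarrow> real^'m^'m"
  assumes "smooth_M0 A" "\<And>p. invertible (A p)"
  shows "smooth_M0 (\<lambda>p. matrix_inv (A p))"
proof (intro smooth_M0_vecI)
  fix k j :: 'm
  let ?C = "\<lambda>p. \<chi> i l. if l = k then axis j 1 $ i else A p $ i $ l"
  have entry: "matrix_inv (A p) $ k $ j = det (?C p) * inverse (det (A p))" for p
  proof -
    have "A p *v (matrix_inv (A p) *v axis j 1) = axis j 1"
      by (rule matrix_inv_mult_vector[OF assms(2)])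
    then have "matrix_inv (A p) *v axis j 1 =
        (\<chi> k. det (\<chi> i l. if l = k then axis j 1 $ i else A p $ i $ l) / det (A p))"
      using cramer[of "A p"] assms(2)[of p] by (simp add: invertible_det_nz)
    then have "column j (matrix_inv (A p)) $ k = det (?C p) / det (A p)"
      by (simp add: matrix_vector_mult_basis)
    then show ?thesis by (simp add: column_def divide_inverse)
  qed
  have "smooth_M0 (\<lambda>p. ?C p $ i $ l)" for i l
    using smooth_M0_nth[OF smooth_M0_nth[OF assms(1), of i], of l]
      smooth_M0_const[where c = "(axis j 1 :: real^'m) $ i"]
    by (cases "l = k") simp_all
  then have "smooth_M0 ?C"
    by (intro smooth_M0_vecI)
  then show "smooth_M0 (\<lambda>p. matrix_inv (A p) $ k $ j)"
    unfolding entry using assms(2)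
    by (intro smooth_M0_mult smooth_M0_inverse smooth_M0_det assms(1)) (simp_all add: invertible_det_nz)
qed


section \<open>The Siegel upper half space\<close>

text \<open>With \<open>Z'\<close> the complex conjugate of \<open>Z\<close>, the matrix \<open>Y + X Y\<^sup>-\<^sup>1 X\<close> is \<open>Z Y\<^sup>-\<^sup>1 Z'\<close>. The two matrices after it
  are the imaginary and the real part of \<open>Z'\<^sup>-\<^sup>1\<close>, as \<open>Omega_mat_entry\<close> confirms.\<close>

definition siegel_P :: "complex^'n^'n \<Rightarrow> real^'n^'n::finite" where
  "siegel_P Z = Im_mat Z + Re_mat Z ** matrix_inv (Im_mat Z) ** Re_mat Z"

definition Im_Omega :: "complex^'n^'n \<Rightarrow> real^'n^'n::finite" where
  "Im_Omega Z = matrix_inv (siegel_P Z)"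

definition Re_Omega :: "complex^'n^'n \<Rightarrow> real^'n^'n::finite" where
  "Re_Omega Z = matrix_inv (Im_mat Z) ** Re_mat Z ** Im_Omega Z"

lemma transpose_eq_iff_inner:
  fixes A :: "real^'n^'n"
  shows "transpose A = A \<longleftrightarrow> (\<forall>u v. u \<bullet> (A *v v) = v \<bullet> (A *v u))"
proof
  assume "transpose A = A"
  then show "\<forall>u v. u \<bullet> (A *v v) = v \<bullet> (A *v u)"
    by (metis dot_lmul_matrix inner_commute transpose_matrix_vector)
next
  assume *: "\<forall>u v. u \<bullet> (A *v v) = v \<bullet> (A *v u)"
  have "A $ i $ j = axis i 1 \<bullet> (A *v axis j 1)" for i j
    by (simp add: matrix_vector_mult_basis inner_axis' column_def)
  with * show "transpose A = A"
    by (simp add: vec_eq_iff transpose_def)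
qed

lemma posdef_invertible:
  fixes A :: "real^'n^'n"
  assumes "\<And>v. v \<noteq> 0 \<Longrightarrow> v \<bullet> (A *v v) > 0"
  shows "invertible A"
proof -
  have "A *v v = 0 \<Longrightarrow> v = 0" for v
    using assms[of v] by auto
  then show ?thesis
    by (simp add: invertible_left_inverse matrix_left_invertible_ker)
qed

context
  fixes Z :: "complex^'n^'n::finite"
  assumes Z: "Z \<in> siegel"
begin

lemma siegel_symmetric: "transpose (Re_mat Z) = Re_mat Z" "transpose (Im_mat Z) = Im_mat Z"
proof -
  have "Z $ i $ j = Z $ j $ i" for i j
    using Z by (auto simp: siegel_def vec_eq_iff transpose_def)
  then show "transpose (Re_mat Z) = Re_mat Z" "transpose (Im_mat Z) = Im_mat Z"
    by (simp_all add: vec_eq_iff transpose_def Re_mat_def Im_mat_def)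
qed

lemma siegel_inner_commute:
  "u \<bullet> (Re_mat Z *v v) = v \<bullet> (Re_mat Z *v u)" "u \<bullet> (Im_mat Z *v v) = v \<bullet> (Im_mat Z *v u)"
  using siegel_symmetric unfolding transpose_eq_iff_inner by auto

lemma siegel_posdef: "v \<noteq> 0 \<Longrightarrow> v \<bullet> (Im_mat Z *v v) > 0"
  using Z by (simp add: siegel_def)

lemma siegel_nonneg: "v \<bullet> (Im_mat Z *v v) \<ge> 0"
  using siegel_posdef[of v] by (cases "v = 0") auto

lemma invertible_Im_mat: "invertible (Im_mat Z)"
  using siegel_posdef by (rule posdef_invertible)

text \<open>In terms of pairs, \<open>v = J\<^sub>Z u\<close> says \<open>(u\<^sub>x, v\<^sub>x) = X (u\<^sub>y, v\<^sub>y) + Y (v\<^sub>y, - u\<^sub>y)\<close>; this form of the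
  definition is free of inverses and symmetric under \<open>(u, v) \<mapsto> (v, - u)\<close>.\<close>

lemma acs_eq_iff:
  "acs Z u = v \<longleftrightarrow>
    fst u = Re_mat Z *v snd u + Im_mat Z *v snd v \<and> fst v = Re_mat Z *v snd v - Im_mat Z *v snd u"
proof -
  let ?X = "Re_mat Z" and ?Y = "Im_mat Z" and ?Y' = "matrix_inv (Im_mat Z)"
  have snd_acs: "snd (acs Z u) = ?Y' *v (fst u - ?X *v snd u)"
    by (simp add: acs_def Let_def matrix_vector_mult_diff_distrib matrix_vector_mul_assoc)
  have fst_acs: "fst (acs Z u) = ?X *v snd (acs Z u) - ?Y *v snd u"
    by (simp add: acs_def Let_def matrix_vector_mult_diff_distrib matrix_vector_mul_assoc
        matrix_vector_mult_add_rdistrib matrix_mul_assoc)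
  have snd_iff: "snd (acs Z u) = w \<longleftrightarrow> fst u = ?X *v snd u + ?Y *v w" for w
  proof -
    have "snd (acs Z u) = w \<longleftrightarrow> fst u - ?X *v snd u = ?Y *v w"
      unfolding snd_acs using matrix_inv_mult_vector[OF invertible_Im_mat] by metis
    then show ?thesis by (simp add: algebra_simps)
  qed
  have "acs Z u = v \<longleftrightarrow> snd (acs Z u) = snd v \<and> fst (acs Z u) = fst v"
    by (auto simp: prod_eq_iff)
  then show ?thesis
    using fst_acs snd_iff[of "snd v"] by metis
qed

lemma fst_acs: "fst (acs Z u) = Re_mat Z *v snd (acs Z u) - Im_mat Z *v snd u"
  and fst_eq_acs: "fst u = Re_mat Z *v snd u + Im_mat Z *v snd (acs Z u)"
  using acs_eq_iff[of u "acs Z u"] by simp_all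

lemma acs_acs: "acs Z (acs Z u) = - u"
  by (subst acs_eq_iff) (simp add: fst_acs fst_eq_acs[symmetric] vec.neg,
      metis fst_eq_acs add_uminus_conv_diff minus_add_distrib)

text \<open>This exhibits \<open>g\<close> as a sum of two squares with respect to \<open>Y\<close>, whence its symmetry and its
  positivity.\<close>

lemma omega0_acs:
  "omega0 u (acs Z v) = snd (acs Z u) \<bullet> (Im_mat Z *v snd (acs Z v)) + snd u \<bullet> (Im_mat Z *v snd v)"
proof -
  have "omega0 u (acs Z v) = fst u \<bullet> snd (acs Z v) - snd u \<bullet> fst (acs Z v)"
    by (simp add: omega0_def inner_vec_def sum_subtractf)
  also have "\<dots> = snd (acs Z v) \<bullet> (Re_mat Z *v snd u) + snd (acs Z v) \<bullet> (Im_mat Z *v snd (acs Z u))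
      - snd u \<bullet> (Re_mat Z *v snd (acs Z v)) + snd u \<bullet> (Im_mat Z *v snd v)"
    by (subst fst_eq_acs, subst fst_acs) (simp add: inner_add_left inner_add_right inner_diff_right inner_commute)
  finally show ?thesis
    using siegel_inner_commute(1)[of "snd u"] siegel_inner_commute(2)[of "snd (acs Z v)"] by simp
qed

lemma omega0_acs_sym: "omega0 u (acs Z v) = omega0 v (acs Z u)"
  unfolding omega0_acs using siegel_inner_commute(2) by simp

lemma omega0_acs_pos:
  assumes "u \<noteq> 0" shows "omega0 u (acs Z u) > 0"
proof -
  have "snd u \<noteq> 0 \<or> snd (acs Z u) \<noteq> 0"
    using assms fst_eq_acs[of u] by (auto simp: prod_eq_iff)
  then show ?thesis
    unfolding omega0_acs using siegel_posdef siegel_nonneg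
    by (meson add_nonneg_pos add_pos_nonneg)
qed

lemma linear_acs: "linear (acs Z)"
  by (intro linearI)
     (simp_all add: acs_def Let_def matrix_vector_right_distrib scaleR_matrix_vector_assoc
       matrix_vector_mult_scaleR algebra_simps)

lemma acs_vertical:
  "acs Z (0, a) = - (siegel_P Z *v a, (matrix_inv (Im_mat Z) ** Re_mat Z) *v a)"
  by (simp add: acs_def Let_def siegel_P_def)

lemma invertible_siegel_P: "invertible (siegel_P Z)"
proof (rule posdef_invertible)
  fix v :: "real^'n"
  assume "v \<noteq> 0"
  then have "omega0 (0, v) (acs Z (0, v)) > 0"
    by (intro omega0_acs_pos) (simp add: zero_prod_def)
  then show "v \<bullet> (siegel_P Z *v v) > 0"
    by (simp add: acs_vertical omega0_def inner_vec_def sum_negf)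
qed

lemma acs_Im_Omega: "acs Z (0, Im_Omega Z *v t) = - (t, Re_Omega Z *v t)"
  by (simp add: acs_vertical Im_Omega_def Re_Omega_def matrix_inv_works[OF invertible_siegel_P]
      matrix_vector_mul_assoc matrix_mul_assoc)

lemma transpose_Im_Omega: "transpose (Im_Omega Z) = Im_Omega Z"
  unfolding transpose_eq_iff_inner
proof (intro allI)
  fix s t
  show "s \<bullet> (Im_Omega Z *v t) = t \<bullet> (Im_Omega Z *v s)"
    using omega0_acs_sym[of "(0, Im_Omega Z *v s)" "(0, Im_Omega Z *v t)"]
    by (simp add: acs_Im_Omega omega0_def inner_vec_def sum_negf mult.commute)
qed

text \<open>The graph of \<open>A\<close> is the image under \<open>J\<close> of the vertical space, which is Lagrangian. As \<open>J\<close> preserves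
  \<open>\<omega>\<^sub>0\<close>, the graph is Lagrangian too, which means that \<open>A\<close> is symmetric.\<close>

lemma transpose_Re_Omega: "transpose (Re_Omega Z) = Re_Omega Z"
  unfolding transpose_eq_iff_inner
proof (intro allI)
  fix s t
  let ?s = "(0, Im_Omega Z *v s)" and ?t = "(0, Im_Omega Z *v t)"
  have "omega0 (acs Z ?s) (acs Z ?t) = omega0 ?t (acs Z (acs Z ?s))"
    by (rule omega0_acs_sym)
  then show "s \<bullet> (Re_Omega Z *v t) = t \<bullet> (Re_Omega Z *v s)"
    by (simp add: acs_acs, simp add: acs_Im_Omega omega0_def inner_vec_def sum_subtractf mult.commute)
qed

lemma Omega_mat_entry:
  "Omega_mat Z $ j $ k = of_real (Re_Omega Z $ j $ k) + \<i> * of_real (Im_Omega Z $ j $ k)"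
proof -
  let ?X = "Re_mat Z" and ?Y = "Im_mat Z" and ?Y' = "matrix_inv (Im_mat Z)" and ?B = "Im_Omega Z"
  have "transpose ?Y' = ?Y'"
  proof -
    have "transpose ?Y' = transpose ?Y' ** (transpose ?Y ** ?Y')"
      by (simp add: siegel_symmetric matrix_inv_works[OF invertible_Im_mat])
    also have "\<dots> = transpose (?Y ** ?Y') ** ?Y'"
      by (simp add: matrix_transpose_mul matrix_mul_assoc)
    finally show ?thesis
      by (simp add: matrix_inv_works[OF invertible_Im_mat])
  qed
  then have "?B ** ?X ** ?Y' = transpose (Re_Omega Z)"
    by (simp add: Re_Omega_def matrix_transpose_mul transpose_Im_Omega siegel_symmetric
        matrix_mul_assoc[symmetric])
  then have re: "?B ** ?X ** ?Y' = Re_Omega Z"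
    by (simp add: transpose_Re_Omega)
  have im: "?B ** ?Y ** ?Y' = ?B"
    by (simp add: matrix_mul_assoc[symmetric] matrix_inv_works[OF invertible_Im_mat])
  have "Omega_mat Z = of_real_mat ?B ** Z ** of_real_mat ?Y'"
    by (simp add: Omega_mat_def Im_Omega_def siegel_P_def Let_def)
  then have "Re (Omega_mat Z $ j $ k) = (?B ** ?X ** ?Y') $ j $ k"
    "Im (Omega_mat Z $ j $ k) = (?B ** ?Y ** ?Y') $ j $ k"
    by (simp_all add: matrix_matrix_mult_def of_real_mat_def Re_mat_def Im_mat_def)
  then show ?thesis
    by (simp add: re im complex_eq_iff)
qed

end

section \<open>Structures that do not depend on the fibre coordinate\<close>

lemma smooth_M0_siegel:
  assumes "smooth_M0 Z" "\<And>p. Z p \<in> siegel"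
  shows "smooth_M0 (\<lambda>p. Im_Omega (Z p))" "smooth_M0 (\<lambda>p. Re_Omega (Z p))" "smooth_M0 (\<lambda>p. acs (Z p) u)"
proof -
  have X: "smooth_M0 (\<lambda>p. Re_mat (Z p))"
    by (intro smooth_M0_vecI)
       (auto simp: Re_mat_def intro!: smooth_M0_linear[OF bounded_linear_Re] smooth_M0_nth assms)
  have Y: "smooth_M0 (\<lambda>p. Im_mat (Z p))"
    by (intro smooth_M0_vecI)
       (auto simp: Im_mat_def intro!: smooth_M0_linear[OF bounded_linear_Im] smooth_M0_nth assms)
  have Y': "smooth_M0 (\<lambda>p. matrix_inv (Im_mat (Z p)))"
    using Y invertible_Im_mat[OF assms(2)] by (rule smooth_M0_matrix_inv)
  have P: "smooth_M0 (\<lambda>p. siegel_P (Z p))"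
    unfolding siegel_P_def by (intro smooth_M0_add smooth_M0_matrix_mult X Y Y')
  show B: "smooth_M0 (\<lambda>p. Im_Omega (Z p))"
    unfolding Im_Omega_def using P invertible_siegel_P[OF assms(2)] by (rule smooth_M0_matrix_inv)
  show "smooth_M0 (\<lambda>p. Re_Omega (Z p))"
    unfolding Re_Omega_def by (intro smooth_M0_matrix_mult X Y' B)
  show "smooth_M0 (\<lambda>p. acs (Z p) u)"
    unfolding acs_def Let_def
    by (intro smooth_M0_Pair smooth_M0_diff smooth_M0_matrix_vector_mult smooth_M0_matrix_mult
        smooth_M0_add smooth_M0_const X Y Y')
qed

lemma smooth_M0_base_has_derivative:
  fixes f :: "'n::finite M0 \<Rightarrow> 'b::real_normed_vector"
  assumes "smooth_M0 f" "\<And>x y. f (x, y) = h x"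
  shows "(h has_derivative frechet_derivative h (at x)) (at x)"
proof -
  have "((\<lambda>x. (x, 0)) has_derivative (\<lambda>s. (s, 0))) (at x)"
    by (intro derivative_eq_intros) auto
  from has_derivative_compose[OF this, of f] smooth_M0_has_derivative[OF assms(1), of "(x, 0)"]
  have "((\<lambda>x. f (x, 0)) has_derivative (\<lambda>s. frechet_derivative f (at (x, 0)) (s, 0))) (at x)"
    by simp
  then show ?thesis
    unfolding assms(2) using frechet_derivative_at by fastforce
qed

text \<open>Both conditions say that the trilinear form with coefficients \<open>L(e\<^sub>i)\<^sub>j\<^sub>k\<close> is symmetric in \<open>i, j\<close>. The
  second one has \<open>j\<close> as the column index, and the symmetry of \<open>L(e\<^sub>i)\<close> accounts for this.\<close>

lemma closed_rows_iff:
  fixes L :: "real^'n \<Rightarrow> real^'n^'n"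
  assumes "linear L" "\<And>s. transpose (L s) = L s"
  shows "(\<forall>i j k. L (axis i 1) $ j $ k = L (axis j 1) $ i $ k) \<longleftrightarrow> (\<forall>s t. L s *v t = L t *v s)"
    (is "?entries \<longleftrightarrow> ?vectors")
proof -
  have sym: "L s $ j $ k = L s $ k $ j" for s j k
    using assms(2)[of s] by (auto simp: vec_eq_iff transpose_def)
  have basis: "L (axis i 1) *v axis j 1 = L (axis i 1) $ j" for i j
    by (simp add: matrix_vector_mult_basis column_def vec_eq_iff sym[of _ _ j])
  have "bilinear (\<lambda>s t. L s *v t)" "bilinear (\<lambda>s t. L t *v s)"
    unfolding bilinear_def
    by (auto intro!: linearI simp: linear_add[OF assms(1)] linear_cmul[OF assms(1)]
        matrix_vector_right_distrib matrix_vector_mult_add_rdistrib matrix_vector_mult_scaleR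
        scaleR_matrix_vector_assoc)
  then have "?vectors \<longleftrightarrow> (\<forall>i j. L (axis i 1) *v axis j 1 = L (axis j 1) *v axis i 1)"
    using bilinear_eq_stdbasis[of "\<lambda>s t. L s *v t" "\<lambda>s t. L t *v s"]
    by (auto simp: fun_eq_iff Basis_vec_def)
  then show ?thesis
    by (simp add: basis vec_eq_iff)
qed

locale invariant_siegel_map =
  fixes Z :: "'n::finite M0 \<Rightarrow> complex^'n^'n"
  assumes smooth_Z: "smooth_M0 Z"
    and siegel_Z: "\<And>p. Z p \<in> siegel"
    and invariant_Z: "\<And>x y y'. Z (x, y) = Z (x, y')"
begin

text \<open>The base point \<open>0\<close> of the fibre is an arbitrary choice, by the invariance of \<open>Z\<close>.\<close>

definition A :: "real^'n \<Rightarrow> real^'n^'n" where "A x = Re_Omega (Z (x, 0))"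
definition B :: "real^'n \<Rightarrow> real^'n^'n" where "B x = Im_Omega (Z (x, 0))"

abbreviation dA :: "real^'n \<Rightarrow> real^'n \<Rightarrow> real^'n^'n" where "dA x \<equiv> frechet_derivative A (at x)"
abbreviation dB :: "real^'n \<Rightarrow> real^'n \<Rightarrow> real^'n^'n" where "dB x \<equiv> frechet_derivative B (at x)"

lemma Re_Omega_eq: "Re_Omega (Z p) = A (fst p)" and Im_Omega_eq: "Im_Omega (Z p) = B (fst p)"
  using invariant_Z[of "fst p" "snd p" 0] by (simp_all add: A_def B_def)

lemma has_derivative_A: "(A has_derivative dA x) (at x)"
  using smooth_M0_siegel(2)[OF smooth_Z siegel_Z]
  by (rule smooth_M0_base_has_derivative) (simp add: Re_Omega_eq)

lemma has_derivative_B: "(B has_derivative dB x) (at x)"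
  using smooth_M0_siegel(1)[OF smooth_Z siegel_Z]
  by (rule smooth_M0_base_has_derivative) (simp add: Im_Omega_eq)

lemma transpose_A: "transpose (A x) = A x" and transpose_B: "transpose (B x) = B x"
  by (simp_all add: A_def B_def transpose_Re_Omega transpose_Im_Omega siegel_Z)

lemma transpose_dA: "transpose (dA x s) = dA x s" and transpose_dB: "transpose (dB x s) = dB x s"
proof -
  have *: "transpose (M' s) = M' s"
    if "(M has_derivative M') (at x)" "\<And>x. transpose (M x) = M x" for M M' :: "real^'n \<Rightarrow> real^'n^'n"
  proof -
    have "linear (transpose :: real^'n^'n \<Rightarrow> real^'n^'n)"
      by (intro linearI) (simp_all add: transpose_def vec_eq_iff)
    from bounded_linear.has_derivative[OF this[unfolded linear_conv_bounded_linear] that(1)]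
    have "(M has_derivative (\<lambda>s. transpose (M' s))) (at x)"
      by (simp add: that(2))
    from has_derivative_unique[OF this that(1)] show ?thesis by (rule fun_cong)
  qed
  show "transpose (dA x s) = dA x s" "transpose (dB x s) = dB x s"
    by (rule *[OF has_derivative_A transpose_A] *[OF has_derivative_B transpose_B])+
qed

sublocale compatible_acs "\<lambda>p. acs (Z p)"
  by (rule compatible_acs.intro)
     (simp_all add: linear_acs acs_acs omega0_acs_sym omega0_acs_pos siegel_Z
       smooth_M0_siegel(3) smooth_Z)

text \<open>The vertical frame is normalised by \<open>B\<close> so that the horizontal part of \<open>J F\<^sub>t\<close> is the constant \<open>- t\<close>.
  In this way the brackets contain no derivative of \<open>siegel_P\<close>.\<close>

definition vertical :: "real^'n \<Rightarrow> 'n M0 \<Rightarrow> 'n tangent" where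
  "vertical t q = (0, B (fst q) *v t)"

lemma smooth_vertical: "vector_field (vertical t)"
  using smooth_M0_siegel(1)[OF smooth_Z siegel_Z]
  unfolding vertical_def Im_Omega_eq
  by (intro smooth_M0_Pair smooth_M0_const smooth_M0_matrix_vector_mult)

lemma J_vertical: "acs (Z q) (vertical t q) = - (t, A (fst q) *v t)"
  using acs_Im_Omega[OF siegel_Z, of q t] by (simp add: vertical_def Im_Omega_eq Re_Omega_eq)

lemma has_derivative_base_matrix:
  fixes M :: "real^'n \<Rightarrow> real^'n^'n"
  assumes "\<And>x. (M has_derivative M' x) (at x)"
  shows "((\<lambda>q :: 'n M0. (c, M (fst q) *v t)) has_derivative (\<lambda>v. (0, M' (fst p) (fst v) *v t))) (at p)"
proof -
  have "linear (\<lambda>N :: real^'n^'n. N *v t)"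
    by (intro linearI) (simp_all add: matrix_vector_mult_add_rdistrib scaleR_matrix_vector_assoc)
  then have "bounded_linear (\<lambda>N :: real^'n^'n. N *v t)"
    by (simp add: linear_conv_bounded_linear)
  from bounded_linear.has_derivative[OF this has_derivative_compose[OF has_derivative_fst[OF has_derivative_ident] assms]]
  show ?thesis
    by (intro has_derivative_Pair has_derivative_const)
qed

lemma along_vertical: "along V (vertical t) p = (0, dB (fst p) (fst (V p)) *v t)"
  unfolding vertical_def
  by (rule along_eqI[OF has_derivative_base_matrix[OF has_derivative_B]])

lemma along_J_vertical: "along V (J_field (vertical t)) p = - (0, dA (fst p) (fst (V p)) *v t)"
  unfolding J_vertical
  by (rule along_eqI[OF has_derivative_minus[OF has_derivative_base_matrix[OF has_derivative_A]]])

lemma linear_dA: "linear (dA x)" and linear_dB: "linear (dB x)"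
  using has_derivative_A has_derivative_B has_derivative_linear by blast+

lemma nijenhuis_vertical:
  "nijenhuis (vertical s) (vertical t) p =
    (0, dA (fst p) s *v t - dA (fst p) t *v s) + acs (Z p) (0, dB (fst p) s *v t - dB (fst p) t *v s)"
proof -
  let ?x = "fst p"
  have fst_J: "fst (acs (Z q) (vertical t q)) = - t" for t q
    by (simp add: J_vertical)
  have fst_V: "fst (vertical t q) = 0" for t q
    by (simp add: vertical_def)
  note lin = linear_0[OF linear_dA] linear_0[OF linear_dB] linear_neg[OF linear_dA] linear_neg[OF linear_dB]
  have minus: "(- M) *v v = - (M *v v)" for M :: "real^'n^'n" and v
    by (simp add: matrix_vector_mult_def vec_eq_iff sum_negf)
  have "lie_bracket (J_field (vertical s)) (J_field (vertical t)) p = (0, dA ?x s *v t - dA ?x t *v s)"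
    by (simp add: lie_bracket_def along_J_vertical fst_J lin minus)
  moreover have "lie_bracket (J_field (vertical s)) (vertical t) p = - (0, dB ?x s *v t)"
    by (simp add: lie_bracket_def along_vertical along_J_vertical fst_J fst_V lin minus)
  moreover have "lie_bracket (vertical s) (J_field (vertical t)) p = (0, dB ?x t *v s)"
    by (simp add: lie_bracket_def along_vertical along_J_vertical fst_J fst_V lin minus)
  moreover have "lie_bracket (vertical s) (vertical t) p = 0"
    by (simp add: lie_bracket_def along_vertical fst_V lin zero_prod_def)
  moreover have "(0 :: real^'n, dB ?x s *v t - dB ?x t *v s) = (0, dB ?x s *v t) - (0, dB ?x t *v s)"
    by simp
  ultimately show ?thesis
    by (simp only: nijenhuis_def J_linear_simps)
       (simp add: algebra_simps)
qed

text \<open>The vertical space and its image under \<open>J\<close> are complementary: this separates the conditions on \<open>A\<close>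
  and on \<open>B\<close> in one direction, and makes the vertical frame sufficient in the other.\<close>

lemma nijenhuis_eq_0_iff:
  "(\<forall>V W. vector_field V \<longrightarrow> vector_field W \<longrightarrow> (\<forall>p. nijenhuis V W p = 0)) \<longleftrightarrow>
    (\<forall>x s t. dA x s *v t = dA x t *v s \<and> dB x s *v t = dB x t *v s)"
    (is "?N \<longleftrightarrow> ?closed")
proof
  assume ?N
  show ?closed
  proof (intro allI)
    fix x s t
    let ?a = "dA x s *v t - dA x t *v s" and ?b = "dB x s *v t - dB x t *v s" and ?p = "(x, 0)"
    have "nijenhuis (vertical s) (vertical t) ?p = 0"
      using \<open>?N\<close> smooth_vertical by blast
    then have 0: "(0, ?a) + acs (Z ?p) (0, ?b) = 0"
      by (simp add: nijenhuis_vertical)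
    then have "siegel_P (Z ?p) *v ?b = 0"
      by (auto simp: acs_vertical[OF siegel_Z] prod_eq_iff)
    then have "?b = 0"
      using matrix_inv_mult_vector(2)[OF invertible_siegel_P[OF siegel_Z], of ?p ?b] by simp
    with 0 have "?a = 0"
      using J_zero[of ?p] by (simp add: zero_prod_def)
    with \<open>?b = 0\<close> show "dA x s *v t = dA x t *v s \<and> dB x s *v t = dB x t *v s"
      by simp
  qed
next
  assume closed: ?closed
  show ?N
  proof (intro allI impI)
    fix V W :: "'n M0 \<Rightarrow> 'n tangent" and p
    assume VW: "vector_field V" "vector_field W"
    have "nijenhuis_at p v w = 0" for v w
    proof (rule nijenhuis_at_eq_0I[where S = "range (\<lambda>t. vertical t p)"])
      fix s t
      assume "s \<in> range (\<lambda>t. vertical t p)" "t \<in> range (\<lambda>t. vertical t p)"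
      then obtain a b where st: "s = vertical a p" "t = vertical b p" by auto
      have "nijenhuis (vertical a) (vertical b) p = 0"
        using closed J_zero[of p] by (simp add: nijenhuis_vertical zero_prod_def)
      then show "nijenhuis_at p s t = 0"
        by (simp add: st nijenhuis_tensorial[OF smooth_vertical smooth_vertical])
    next
      fix v
      let ?P = "siegel_P (Z p)"
      have onto: "(0, c) = vertical (?P *v c) p" for c
        using matrix_inv_mult_vector(2)[OF invertible_siegel_P[OF siegel_Z], of p c]
        by (simp add: vertical_def Im_Omega_eq[symmetric] Im_Omega_def)
      have "v = (0, snd v + A (fst p) *v - fst v) + acs (Z p) (vertical (- fst v) p)"
        by (simp add: J_vertical prod_eq_iff)
      then show "\<exists>s\<in>range (\<lambda>t. vertical t p). \<exists>t\<in>range (\<lambda>t. vertical t p). v = s + acs (Z p) t"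
        unfolding onto by blast
    qed
    then show "nijenhuis V W p = 0"
      by (simp add: nijenhuis_tensorial[OF VW])
  qed
qed

definition \<Omega> :: "real^'n \<Rightarrow> complex^'n^'n" where
  "\<Omega> x = (\<chi> j k. of_real (A x $ j $ k) + \<i> * of_real (B x $ j $ k))"

definition d\<Omega> :: "real^'n \<Rightarrow> real^'n \<Rightarrow> complex^'n^'n" where
  "d\<Omega> x s = (\<chi> j k. of_real (dA x s $ j $ k) + \<i> * of_real (dB x s $ j $ k))"

lemma Omega_mat_eq: "Omega_mat (Z p) = \<Omega> (fst p)"
  by (simp add: vec_eq_iff \<Omega>_def Omega_mat_entry[OF siegel_Z] Re_Omega_eq Im_Omega_eq)

lemma has_derivative_\<Omega>: "(\<Omega> has_derivative d\<Omega> x) (at x)"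
proof -
  let ?h = "\<lambda>M :: (real^'n^'n) \<times> (real^'n^'n). \<chi> j k. of_real (fst M $ j $ k) + \<i> * of_real (snd M $ j $ k)"
  have "linear ?h"
    by (intro linearI) (simp_all add: vec_eq_iff complex_eq_iff)
  then have "bounded_linear ?h"
    by (simp add: linear_conv_bounded_linear)
  from bounded_linear.has_derivative[OF this has_derivative_Pair[OF has_derivative_A has_derivative_B]]
  show ?thesis
    by (simp add: \<Omega>_def[abs_def] d\<Omega>_def[abs_def])
qed

lemma partial_\<Omega>: "partial i \<Omega> x = d\<Omega> x (axis i 1)"
  using frechet_derivative_at[OF has_derivative_\<Omega>] by (simp add: partial_def)

lemma partial_\<Omega>_entry: "partial i (\<lambda>x. \<Omega> x $ j $ k) x = d\<Omega> x (axis i 1) $ j $ k"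
proof -
  have "((\<lambda>x. \<Omega> x $ j $ k) has_derivative (\<lambda>s. d\<Omega> x s $ j $ k)) (at x)"
    by (intro bounded_linear.has_derivative[OF bounded_linear_vec_nth] has_derivative_\<Omega>)
  from fun_cong[OF frechet_derivative_at[OF this], of "axis i 1"] show ?thesis
    by (simp add: partial_def)
qed

lemma closed_\<Omega>_iff:
  "(\<forall>i j k x. partial i (\<lambda>x. \<Omega> x $ j $ k) x = partial j (\<lambda>x. \<Omega> x $ i $ k) x) \<longleftrightarrow>
    (\<forall>x s t. dA x s *v t = dA x t *v s \<and> dB x s *v t = dB x t *v s)"
proof -
  have "(\<forall>i j k x. partial i (\<lambda>x. \<Omega> x $ j $ k) x = partial j (\<lambda>x. \<Omega> x $ i $ k) x) \<longleftrightarrow>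
      (\<forall>x. (\<forall>i j k. dA x (axis i 1) $ j $ k = dA x (axis j 1) $ i $ k) \<and>
           (\<forall>i j k. dB x (axis i 1) $ j $ k = dB x (axis j 1) $ i $ k))"
    unfolding partial_\<Omega>_entry by (auto simp: d\<Omega>_def complex_eq_iff)
  then show ?thesis
    by (simp add: closed_rows_iff[OF linear_dA transpose_dA] closed_rows_iff[OF linear_dB transpose_dB]
        all_conj_distrib)
qed

text \<open>The points \<open>m = e\<^sub>k\<close> and \<open>m = 0\<close> give vectors \<open>m - N x\<close> whose difference is \<open>e\<^sub>k\<close>, so the two instances
  of integrability isolate the \<open>k\<close>-th column.\<close>

lemma integrable_iff_closed:
  "(\<forall>m. integrable_point N \<Omega> m) \<longleftrightarrow>
    (\<forall>i j k x. partial i (\<lambda>x. \<Omega> x $ j $ k) x = partial j (\<lambda>x. \<Omega> x $ i $ k) x)"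
    (is "?int \<longleftrightarrow> ?closed")
proof
  assume closed: ?closed
  then show ?int
    by (simp add: integrable_point_def partial_\<Omega> partial_\<Omega>_entry matrix_vector_mult_def Let_def)
next
  assume int: ?int
  show ?closed
  proof (intro allI)
    fix i j k x
    let ?w = "\<lambda>m :: int^'n. \<chi> l. complex_of_real (of_int (m $ l) - of_nat N * x $ l)"
    have w: "(d\<Omega> x (axis i 1) *v ?w m) $ j = (d\<Omega> x (axis j 1) *v ?w m) $ i" for m
      using int by (simp add: integrable_point_def partial_\<Omega> Let_def)
    have "?w (axis k 1) - ?w 0 = axis k 1"
      by (simp add: vec_eq_iff axis_def)
    then have entry: "(M *v ?w (axis k 1)) $ l - (M *v ?w 0) $ l = M $ l $ k" for M :: "complex^'n^'n" and l
    proof -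
      have "M *v axis k 1 = column k M"
        by (simp add: vec_eq_iff matrix_vector_mult_def axis_def column_def if_distrib cong: if_cong)
      then have "(M *v (?w (axis k 1) - ?w 0)) $ l = M $ l $ k"
        using \<open>?w (axis k 1) - ?w 0 = axis k 1\<close> by (simp add: column_def)
      then show ?thesis
        by (simp only: matrix_vector_mult_diff_distrib vector_minus_component)
    qed
    have "d\<Omega> x (axis i 1) $ j $ k = d\<Omega> x (axis j 1) $ i $ k"
      unfolding entry[symmetric] w ..
    then show "partial i (\<lambda>x. \<Omega> x $ j $ k) x = partial j (\<lambda>x. \<Omega> x $ i $ k) x"
      unfolding partial_\<Omega>_entry .
  qed
qed

end


section \<open>The three conditions\<close>

theorem proposition3p14:
  fixes N :: nat
    and Z :: "'n::finite M0 \<Rightarrow> complex^'n^'n"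
    and J :: "'n M0 \<Rightarrow> 'n tangent \<Rightarrow> 'n tangent"
    and g :: "'n M0 \<Rightarrow> 'n tangent \<Rightarrow> 'n tangent \<Rightarrow> real"
    and \<Omega> :: "real^'n \<Rightarrow> complex^'n^'n"
  assumes "N > 0"
    and "smooth_M0 Z"
    and "\<And>p. Z p \<in> siegel"
    and "\<And>x y y'. Z (x, y) = Z (x, y')"
    and "\<And>p. J p = acs (Z p)"
    and "\<And>p u v. g p u v = omega0 u (J p v)"
    and "\<And>x y. \<Omega> x = Omega_mat (Z (x, y))"
  shows "((\<forall>m. integrable_point N \<Omega> m)
            \<longleftrightarrow> (\<forall>i j k x. partial i (\<lambda>x. \<Omega> x $ j $ k) x = partial j (\<lambda>x. \<Omega> x $ i $ k) x))
       \<and> ((\<forall>i j k x. partial i (\<lambda>x. \<Omega> x $ j $ k) x = partial j (\<lambda>x. \<Omega> x $ i $ k) x)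
            \<longleftrightarrow> parallel_endo (levi_civita g) J)"
proof -
  interpret Z: invariant_siegel_map Z
    using assms(2-4) by unfold_locales
  have J: "J = (\<lambda>p. acs (Z p))"
    using assms(5) by (rule ext)
  have g: "g = (\<lambda>p u v. omega0 u (acs (Z p) v))"
    by (simp add: fun_eq_iff assms(6) J)
  have \<Omega>: "\<Omega> = Z.\<Omega>"
    by (rule ext) (simp add: assms(7)[of _ 0] Z.Omega_mat_eq)
  have "parallel_endo (levi_civita g) J \<longleftrightarrow>
      (\<forall>i j k x. partial i (\<lambda>x. Z.\<Omega> x $ j $ k) x = partial j (\<lambda>x. Z.\<Omega> x $ i $ k) x)"
    unfolding J g Z.parallel_iff_nijenhuis[OF Z.is_levi_civita_levi_civita]
    by (simp only: Z.nijenhuis_eq_0_iff Z.closed_\<Omega>_iff)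
  then show ?thesis
    unfolding \<Omega> using Z.integrable_iff_closed by blast
qed

end
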